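(* Let $H:\mathbb{R}^3\to\mathbb{R}^3$ be the map \[ H(x,y,z) = (1.76 - y^2 - 0.1 z,\ x,\ y), \] and let $f = H^4$ be its fourth iterate. Let $B=[-1,1]^3=\overline{\mathbb{B}_2}\times\overline{\mathbb{B}_1}$ and define the affine homeomorphisms $C_a, C_b:\mathbb{R}^3\to\mathbb{R}^3$ by \[ C_a^{-1}(v) = \begin{bmatrix} 0.81 \\ 1.0225 \\ 0.975 \end{bmatrix} + \begin{bmatrix} 0 & 0.19 & -0.03 \\ 0.1825 & 0 & 0 \\ 0 & -0.095 & -0.06 \end{bmatrix} v, \qquad C_b^{-1}(v) = \begin{bmatrix} 0.81 \\ 1.4875 \\ 0.975 \end{bmatrix} + \begin{bmatrix} 0 & 0.19 & -0.03 \\ 0.1225 & 0 & 0 \\ 0 & -0.095 & -0.06 \end{bmatrix} v . \] Let $N_a=(a,2,1,C_a)$ and $N_b=(b,2,1,C_b)$ be the h-sets with supports $a=C_a^{-1}(B)$ and $b=C_b^{-1}(B)$, exit dimension $2$ and entry dimension $1$. Then the covering relations \[ N_a \overset{H^4}{\Longrightarrow} N_a,\qquad N_a \overset{H^4}{\Longrightarrow} N_b,\qquad N_b \overset{H^4}{\Longrightarrow} N_b,\qquad N_b \overset{H^4}{\Longrightarrow} N_a \] all hold. Consequently $H^4$ has symbolic dynamics: with $I=\operatorname{Inv}_{H^4}(a\cup b)$ the invariant part of $a\cup b$ under $H^4$, the map $g:I\to\Sigma_2$ given by $g(x)_k = 0$ if $H^{4k}(x)\in a$ and $g(x)_k=1$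 if $H^{4k}(x)\in b$ ($k\in\mathbb{Z}$) is a continuous surjection satisfying $g\circ H^4|_I = \sigma\circ g$.
   Context: Notation: $\mathbb{B}_k=\{x\in\mathbb{R}^k:\|x\|_\infty<1\}$ is the open unit cube in $\mathbb{R}^k$. An h-set in $\mathbb{R}^n$ is a quadruple $N=(|N|,u(N),s(N),C_N)$ where $|N|\subset\mathbb{R}^n$ is compact, $u(N),s(N)\ge 0$ are integers with $u(N)+s(N)=n$, and $C_N:\mathbb{R}^n\to\mathbb{R}^{u(N)}\times\mathbb{R}^{s(N)}$ is a homeomorphism with $C_N(|N|)=N_c:=\overline{\mathbb{B}_{u(N)}}\times\overline{\mathbb{B}_{s(N)}}$. Write $N_c^-=\partial\mathbb{B}_{u(N)}\times\overline{\mathbb{B}_{s(N)}}$ (exit set) and $N_c^+=\overline{\mathbb{B}_{u(N)}}\times\partial\mathbb{B}_{s(N)}$ (entry set). Covering relation: for h-sets $M,N$ with $u(M)=u(N)=u$, $s(M)=s(N)=s$ and a continuous map $f:|M|\to\mathbb{R}^n$, put $f_c=C_N\circ f\circ C_M^{-1}:M_c\to\mathbb{R}^u\times\mathbb{R}^s$. We say $M$ $f$-covers $N$, written $M\overset{f}{\Longrightarrow}N$, if there is a continuous homotopy $h:[0,1]\times M_c\to\mathbb{R}^u\times\mathbb{R}^s$ with (1) $h_0=f_c$; (2) $h([0,1],M_c^-)\cap N_c=\varnothing$; (3) $h([0,1],M_c)\cap N_c^+=\varnothing$; (4) if $u>0$, there is a linear map $A:\mathbb{R}^u\to\mathbb{R}^u$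 with $h_1(x,y)=(A(x),0)$ for all $x\in\overline{\mathbb{B}_u}$, $y\in\overline{\mathbb{B}_s}$, and $A(\partial\mathbb{B}_u)\subset\mathbb{R}^u\setminus\mathbb{B}_u$. Symbolic dynamics: $\Sigma_2=\{0,1\}^{\mathbb{Z}}$ with the metric $\operatorname{dist}(l,l')=\sum_{n\in\mathbb{Z}}|l_n-l'_n|/2^{|n|}$ (product topology), and $\sigma:\Sigma_2\to\Sigma_2$ is the shift $(\sigma(l))_n=l_{n+1}$. The invariant part of a set $M$ under a homeomorphism $F$ is $\operatorname{Inv}_F(M)=\{x\in M: F^n(x)\in M \text{ for all } n\in\mathbb{Z}\}$. *)

theory Defs
  imports "HOL-Analysis.Analysis"
begin

definition open_cube :: "'a::euclidean_space set" where
  "open_cube = box (-One) One"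

definition closed_cube :: "'a::euclidean_space set" where
  "closed_cube = cbox (-One) One"

definition Nc :: "('u::euclidean_space \<times> 's::euclidean_space) set" where
  "Nc = closed_cube \<times> closed_cube"

definition Nc_minus :: "('u::euclidean_space \<times> 's::euclidean_space) set" where
  "Nc_minus = frontier open_cube \<times> closed_cube"

definition Nc_plus :: "('u::euclidean_space \<times> 's::euclidean_space) set" where
  "Nc_plus = closed_cube \<times> frontier open_cube"

definition is_hset :: "'n::euclidean_space set \<Rightarrow> ('n \<Rightarrow> 'u::euclidean_space \<times> 's::euclidean_space) \<Rightarrow> bool" where
  "is_hset S C \<longleftrightarrow> compact S \<and> (\<exists>g. homeomorphism UNIV UNIV C g) \<and> C ` S = Nc"

text \<open>Covering relation  M =f=> N  (here u = DIM('u) \<ge> 1, so condition (4) always applies).\<close>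
definition covers ::
  "'n::euclidean_space set \<Rightarrow> ('n \<Rightarrow> 'u::euclidean_space \<times> 's::euclidean_space)
   \<Rightarrow> ('n \<Rightarrow> 'n) \<Rightarrow> 'n set \<Rightarrow> ('n \<Rightarrow> 'u \<times> 's) \<Rightarrow> bool" where
  "covers M CM f N CN \<longleftrightarrow>
     is_hset M CM \<and> is_hset N CN \<and> continuous_on M f \<and>
     (\<exists>h :: real \<times> ('u \<times> 's) \<Rightarrow> 'u \<times> 's.
        continuous_on ({0..1} \<times> Nc) h \<and>
        (\<forall>p\<in>Nc. h (0, p) = CN (f (inv CM p))) \<and>
        (\<forall>t\<in>{0..1}. \<forall>p\<in>Nc_minus. h (t, p) \<notin> Nc) \<and>
        (\<forall>t\<in>{0..1}. \<forall>p\<in>Nc. h (t, p) \<notin> Nc_plus) \<and>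
        (\<exists>A. linear A \<and>
             (\<forall>x\<in>closed_cube. \<forall>y\<in>closed_cube. h (1, (x, y)) = (A x, 0)) \<and>
             A ` frontier open_cube \<subseteq> - open_cube))"

definition Sigma2 :: "(int \<Rightarrow> int) set" where
  "Sigma2 = {l. \<forall>n. l n \<in> {0, 1}}"

definition sigma_dist :: "(int \<Rightarrow> int) \<Rightarrow> (int \<Rightarrow> int) \<Rightarrow> real" where
  "sigma_dist l l' = (\<Sum>\<^sub>\<infinity>n\<in>(UNIV::int set). real_of_int \<bar>l n - l' n\<bar> / 2 ^ nat \<bar>n\<bar>)"

definition shift :: "(int \<Rightarrow> int) \<Rightarrow> (int \<Rightarrow> int)" where
  "shift l = (\<lambda>n. l (n + 1))"

definition iter_int :: "('a \<Rightarrow> 'a) \<Rightarrow> int \<Rightarrow> 'a \<Rightarrow> 'a" where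
  "iter_int F n = (if 0 \<le> n then F ^^ nat n else (inv F) ^^ nat (- n))"

definition Inv_part :: "('a \<Rightarrow> 'a) \<Rightarrow> 'a set \<Rightarrow> 'a set" where
  "Inv_part F M = {x \<in> M. \<forall>n::int. iter_int F n x \<in> M}"

definition H :: "real^3 \<Rightarrow> real^3" where
  "H v = vector [1.76 - (v$2)^2 - 0.1 * v$3, v$1, v$2]"

definition split3 :: "real^3 \<Rightarrow> (real^2) \<times> (real^1)" where
  "split3 v = (vector [v$1, v$2], vector [v$3])"

definition Ma :: "real^3^3" where
  "Ma = vector [vector [0, 0.19, -0.03], vector [0.1825, 0, 0], vector [0, -0.095, -0.06]]"

definition Mb :: "real^3^3" where
  "Mb = vector [vector [0, 0.19, -0.03], vector [0.1225, 0, 0], vector [0, -0.095, -0.06]]"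

definition Ca_inv :: "real^3 \<Rightarrow> real^3" where
  "Ca_inv v = vector [0.81, 1.0225, 0.975] + Ma *v v"

definition Cb_inv :: "real^3 \<Rightarrow> real^3" where
  "Cb_inv v = vector [0.81, 1.4875, 0.975] + Mb *v v"

definition Ca :: "real^3 \<Rightarrow> real^3" where "Ca = inv Ca_inv"
definition Cb :: "real^3 \<Rightarrow> real^3" where "Cb = inv Cb_inv"

definition Bcube :: "(real^3) set" where "Bcube = cbox (-1) 1"

definition set_a :: "(real^3) set" where "set_a = Ca_inv ` Bcube"
definition set_b :: "(real^3) set" where "set_b = Cb_inv ` Bcube"

end

theory Submission
  imports Defs
begin

text \<open>In the charts of the two h-sets, \<^term>\<open>H ^^ 4\<close> stretches the first two coordinates: it maps
  each face \<open>v$1 = \<plusminus>1\<close>, \<open>v$2 = \<plusminus>1\<close> strictly beyond the unit cube, on the same side (on the opposite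
  side for the first coordinate of b, where the orientation is reversed); and it maps the third
  coordinate into (-1,1) wherever the second coordinate of the image is in [-1,1]. This gives the covering
  relations, with a diagonal linear model map.

  To realise a bi-infinite symbol sequence no degree theory is needed. The equations for an orbit,
  in the chart coordinates of all of its points, form a system indexed by pairs (time, coordinate),
  and the same sign conditions are those of the Poincare-Miranda theorem on the Hilbert cube, which
  follows from the finite-dimensional combinatorial lemma of Kuhn by compactness.\<close>

subsection \<open>A Poincare-Miranda theorem on the Hilbert cube\<close>

lemma tendsto_fun_iff:
  fixes f :: "'a \<Rightarrow> 'i \<Rightarrow> 'b::topological_space"
  shows "(f \<longlongrightarrow> l) F \<longleftrightarrow> (\<forall>i. ((\<lambda>x. f x i) \<longlongrightarrow> l i) F)"
  using limitin_componentwise[of "\<lambda>_. euclidean" UNIV f l F]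
  by (simp add: euclidean_product_topology)

lemma compact_PiE_UNIV:
  fixes S :: "'i \<Rightarrow> 'b::topological_space set"
  assumes "\<And>i. compact (S i)"
  shows "compact {x. \<forall>i. x i \<in> S i}"
proof -
  have "compactin (product_topology (\<lambda>_. euclidean) UNIV) (PiE UNIV S)"
    using assms by (simp add: compactin_PiE)
  moreover have "PiE UNIV S = {x. \<forall>i. x i \<in> S i}"
    by (auto simp: PiE_UNIV_domain)
  ultimately show ?thesis
    by (simp add: euclidean_product_topology)
qed

text \<open>Kuhn's lemma is applied to a grid with \<open>Suc p\<close> steps per axis in the first
  \<open>Suc p\<close> coordinates, the others frozen at 0. Two vertices of the resulting cell with
  different \<open>i\<close>-labels are the points \<open>r\<close> and \<open>s\<close>; the cell
  has side \<open>2 / Suc p\<close>.\<close>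

lemma miranda_approx:
  fixes G :: "(nat \<Rightarrow> real) \<Rightarrow> nat \<Rightarrow> real"
  defines "D \<equiv> {x::nat \<Rightarrow> real. \<forall>i. x i \<in> {-1..1}}"
  assumes lo: "\<And>x i. x \<in> D \<Longrightarrow> x i = -1 \<Longrightarrow> G x i \<le> 0"
    and hi: "\<And>x i. x \<in> D \<Longrightarrow> x i = 1 \<Longrightarrow> G x i \<ge> 0"
  shows "\<exists>z\<in>D. \<forall>i<Suc p. \<exists>r\<in>D. \<exists>s\<in>D. G r i \<le> 0 \<and> G s i \<ge> 0 \<and>
    (\<forall>j. \<bar>r j - z j\<bar> \<le> 2 / Suc p \<and> \<bar>s j - z j\<bar> \<le> 2 / Suc p)"
proof -
  define n where "n = Suc p"
  have n: "n > 0" by (simp add: n_def)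
  define emb :: "(nat \<Rightarrow> nat) \<Rightarrow> nat \<Rightarrow> real"
    where "emb x j = (if j < n then -1 + 2 * (x j / n) else 0)" for x j
  \<comment> \<open>The faces are labelled by position, not by sign: at a zero of \<open>G\<close>
    on an upper face the sign rule would give 0, where Kuhn's lemma demands 1. By \<open>lo\<close>
    and \<open>hi\<close> the labels still reflect weak signs of \<open>G\<close>.\<close>
  define label :: "(nat \<Rightarrow> nat) \<Rightarrow> nat \<Rightarrow> nat"
    where "label x i = (if x i = 0 then 0 else if x i = n then 1 else if G (emb x) i \<le> 0 then 0 else 1)"
    for x i
  have embD: "emb x \<in> D" if "\<forall>i<n. x i \<le> n" for x
    using that n unfolding D_def emb_def by (auto simp: field_simps)
  have label0: "G (emb x) i \<le> 0" if "\<forall>i<n. x i \<le> n" "i < n" "label x i = 0" for x i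
    using that lo[OF embD[OF that(1)], of i] by (auto simp: label_def emb_def split: if_splits)
  have label1: "G (emb x) i \<ge> 0" if "\<forall>i<n. x i \<le> n" "i < n" "label x i \<noteq> 0" for x i
    using that hi[OF embD[OF that(1)], of i] n by (auto simp: label_def emb_def split: if_splits)
  obtain q where q: "\<forall>i<n. q i < n"
    and rs: "\<forall>i<n. \<exists>r s. (\<forall>j<n. q j \<le> r j \<and> r j \<le> q j + 1) \<and>
       (\<forall>j<n. q j \<le> s j \<and> s j \<le> q j + 1) \<and> label r i \<noteq> label s i"
    by (rule kuhn_lemma[of n n label]) (use n in \<open>auto simp: label_def\<close>)
  have near: "\<bar>emb r j - emb q j\<bar> \<le> 2 / n" if "\<forall>j<n. q j \<le> r j \<and> r j \<le> q j + 1" for r j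
  proof (cases "j < n")
    case True
    then have "\<bar>real (r j) - real (q j)\<bar> \<le> 1" using that by (auto simp: abs_le_iff)
    moreover have "emb r j - emb q j = 2 * (real (r j) - real (q j)) / n"
      using True by (simp add: emb_def diff_divide_distrib)
    ultimately show ?thesis by (simp add: divide_right_mono)
  qed (simp add: emb_def)
  have "\<exists>r\<in>D. \<exists>s\<in>D. G r i \<le> 0 \<and> G s i \<ge> 0 \<and>
      (\<forall>j. \<bar>r j - emb q j\<bar> \<le> 2 / n \<and> \<bar>s j - emb q j\<bar> \<le> 2 / n)" if i: "i < n" for i
  proof -
    obtain r s where r: "\<forall>j<n. q j \<le> r j \<and> r j \<le> q j + 1"
      and s: "\<forall>j<n. q j \<le> s j \<and> s j \<le> q j + 1" and ne: "label r i \<noteq> label s i"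
      using rs i by blast
    have rn: "\<forall>j<n. r j \<le> n" and sn: "\<forall>j<n. s j \<le> n"
      using q r s by (metis Suc_eq_plus1 Suc_leI order_trans)+
    show ?thesis
    proof (cases "label r i = 0")
      case True
      then show ?thesis
        using label0[OF rn i] label1[OF sn i] embD[OF rn] embD[OF sn] near[OF r] near[OF s] ne
        by metis
    next
      case False
      moreover from False ne have "label s i = 0" by (auto simp: label_def split: if_splits)
      ultimately show ?thesis
        using label0[OF sn i] label1[OF rn i] embD[OF rn] embD[OF sn] near[OF r] near[OF s]
        by metis
    qed
  qed
  moreover have "emb q \<in> D" using q by (intro embD) (simp add: less_imp_le)
  ultimately show ?thesis unfolding n_def by blast
qed

text \<open>By compactness the approximate zeros accumulate at some \<open>x\<close>. The nearby
  points with \<open>G\<close> nonpositive and nonnegative in coordinate \<open>i\<close> converge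
  to the same \<open>x\<close>, so continuity forces the value 0. Each coordinate is controlled from
  stage \<open>i\<close> on, which suffices for a limit in the product topology.\<close>

lemma poincare_miranda_nat:
  fixes G :: "(nat \<Rightarrow> real) \<Rightarrow> nat \<Rightarrow> real"
  defines "D \<equiv> {x::nat \<Rightarrow> real. \<forall>i. x i \<in> {-1..1}}"
  assumes cont: "\<And>i. continuous_on D (\<lambda>x. G x i)"
    and lo: "\<And>x i. x \<in> D \<Longrightarrow> x i = -1 \<Longrightarrow> G x i \<le> 0"
    and hi: "\<And>x i. x \<in> D \<Longrightarrow> x i = 1 \<Longrightarrow> G x i \<ge> 0"
  shows "\<exists>x\<in>D. \<forall>i. G x i = 0"
proof -
  have "\<forall>p. \<exists>z. z \<in> D \<and> (\<forall>i<Suc p. \<exists>r\<in>D. \<exists>s\<in>D. G r i \<le> 0 \<and> G s i \<ge> 0 \<and>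
    (\<forall>j. \<bar>r j - z j\<bar> \<le> 2 / Suc p \<and> \<bar>s j - z j\<bar> \<le> 2 / Suc p))"
    using miranda_approx[of G] lo hi unfolding D_def by blast
  then obtain z where z: "\<And>p. z p \<in> D" and
    rs: "\<And>p i. i < Suc p \<Longrightarrow> \<exists>r\<in>D. \<exists>s\<in>D. G r i \<le> 0 \<and> G s i \<ge> 0 \<and>
    (\<forall>j. \<bar>r j - z p j\<bar> \<le> 2 / Suc p \<and> \<bar>s j - z p j\<bar> \<le> 2 / Suc p)"
    by metis
  have "compact D" unfolding D_def by (rule compact_PiE_UNIV) simp
  then have "seq_compact D" by (simp add: compact_eq_seq_compact_metric)
  then obtain x k where x: "x \<in> D" "strict_mono k" "(z \<circ> k) \<longlonglongrightarrow> x"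
    using z by (metis seq_compactE)
  have zlim: "(\<lambda>p. z (k p) j) \<longlonglongrightarrow> x j" for j
    using x(3) by (simp add: tendsto_fun_iff o_def)
  have small: "(\<lambda>p. 2 / real (Suc (k p))) \<longlonglongrightarrow> 0"
  proof -
    have "(\<lambda>p. 2 / real (Suc p)) \<longlonglongrightarrow> 0"
      using tendsto_mult_right_zero[OF LIMSEQ_inverse_real_of_nat, of 2] by (simp add: field_simps)
    from LIMSEQ_subseq_LIMSEQ[OF this x(2)] show ?thesis by (simp add: o_def)
  qed
  have lim: "(\<lambda>p. G (y p) i) \<longlonglongrightarrow> G x i"
    if y: "\<And>p. y p \<in> D" "\<And>p. i \<le> k p \<Longrightarrow> \<forall>j. \<bar>y p j - z (k p) j\<bar> \<le> 2 / Suc (k p)" for y i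
  proof -
    have ev: "eventually (\<lambda>p. i \<le> k p) sequentially"
      using eventually_ge_at_top[of i]
      by eventually_elim (use x(2) in \<open>meson order_trans seq_suble\<close>)
    have "(\<lambda>p. y p j) \<longlonglongrightarrow> x j" for j
    proof -
      have "(\<lambda>p. y p j - z (k p) j) \<longlonglongrightarrow> 0"
        by (rule Lim_null_comparison[OF _ small]) (use ev y(2) in \<open>auto elim!: eventually_mono\<close>)
      from tendsto_add[OF this zlim[of j]] show ?thesis by simp
    qed
    then have "y \<longlonglongrightarrow> x" by (simp add: tendsto_fun_iff)
    then show ?thesis
      using cont[of i] x(1) y(1) unfolding continuous_on_sequentially o_def by blast
  qed
  have "G x i = 0" for i
  proof -
    have ev: "eventually (\<lambda>p. i \<le> k p) sequentially"
      using eventually_ge_at_top[of i]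
      by eventually_elim (use x(2) in \<open>meson order_trans seq_suble\<close>)
    have "\<forall>p. \<exists>r s. r \<in> D \<and> s \<in> D \<and> (i \<le> k p \<longrightarrow> G r i \<le> 0 \<and> G s i \<ge> 0 \<and>
      (\<forall>j. \<bar>r j - z (k p) j\<bar> \<le> 2 / Suc (k p)) \<and> (\<forall>j. \<bar>s j - z (k p) j\<bar> \<le> 2 / Suc (k p)))"
    proof
      fix p
      show "\<exists>r s. r \<in> D \<and> s \<in> D \<and> (i \<le> k p \<longrightarrow> G r i \<le> 0 \<and> G s i \<ge> 0 \<and>
        (\<forall>j. \<bar>r j - z (k p) j\<bar> \<le> 2 / Suc (k p)) \<and> (\<forall>j. \<bar>s j - z (k p) j\<bar> \<le> 2 / Suc (k p)))"
      proof (cases "i \<le> k p")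
        case True
        with rs[of i "k p"] show ?thesis by (metis less_Suc_eq_le)
      next
        \<comment> \<open>At the finitely many stages that do not yet control coordinate
          \<open>i\<close>, the limit point serves as filler.\<close>
        case False
        with x(1) show ?thesis by blast
      qed
    qed
    then obtain r s where rs': "\<And>p. r p \<in> D" "\<And>p. s p \<in> D"
      "\<And>p. i \<le> k p \<Longrightarrow> G (r p) i \<le> 0" "\<And>p. i \<le> k p \<Longrightarrow> G (s p) i \<ge> 0"
      "\<And>p. i \<le> k p \<Longrightarrow> \<forall>j. \<bar>r p j - z (k p) j\<bar> \<le> 2 / Suc (k p)"
      "\<And>p. i \<le> k p \<Longrightarrow> \<forall>j. \<bar>s p j - z (k p) j\<bar> \<le> 2 / Suc (k p)"
      by metis
    have "G x i \<le> 0"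
      by (rule tendsto_upperbound[OF lim[of r i]]) (use rs' ev in \<open>auto elim!: eventually_mono\<close>)
    moreover have "G x i \<ge> 0"
      by (rule tendsto_lowerbound[OF lim[of s i]]) (use rs' ev in \<open>auto elim!: eventually_mono\<close>)
    ultimately show ?thesis by simp
  qed
  with x(1) show ?thesis by blast
qed

text \<open>The system is transported along \<open>to_nat\<close>. A natural number that codes no
  index receives the equation \<open>x n = 0\<close>, which satisfies both sign conditions
  trivially.\<close>

lemma poincare_miranda_countable:
  fixes G :: "('i::countable \<Rightarrow> real) \<Rightarrow> 'i \<Rightarrow> real"
  defines "D \<equiv> {x::'i \<Rightarrow> real. \<forall>i. x i \<in> {-1..1}}"
  assumes cont: "\<And>i. continuous_on D (\<lambda>x. G x i)"
    and lo: "\<And>x i. x \<in> D \<Longrightarrow> x i = -1 \<Longrightarrow> G x i \<le> 0"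
    and hi: "\<And>x i. x \<in> D \<Longrightarrow> x i = 1 \<Longrightarrow> G x i \<ge> 0"
  shows "\<exists>x\<in>D. \<forall>i. G x i = 0"
proof -
  define G' :: "(nat \<Rightarrow> real) \<Rightarrow> nat \<Rightarrow> real" where
    "G' x n = (if n \<in> range (to_nat :: 'i \<Rightarrow> nat) then G (x \<circ> to_nat) (from_nat n) else x n)" for x n
  let ?D = "{x::nat \<Rightarrow> real. \<forall>i. x i \<in> {-1..1}}"
  have "\<exists>x\<in>?D. \<forall>n. G' x n = 0"
  proof (rule poincare_miranda_nat)
    fix n
    have "continuous_on ?D (\<lambda>x. x \<circ> (to_nat :: 'i \<Rightarrow> nat))"
      unfolding o_def
      by (intro continuous_on_coordinatewise_then_product continuous_on_subset[OF continuous_on_product_coordinates]) simp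
    then have "continuous_on ?D (\<lambda>x. G (x \<circ> to_nat) i)" for i
      by (rule continuous_on_compose2[OF cont]) (auto simp: D_def)
    moreover have "continuous_on ?D (\<lambda>x. x n)"
      by (rule continuous_on_subset[OF continuous_on_product_coordinates]) simp
    ultimately show "continuous_on ?D (\<lambda>x. G' x n)"
      unfolding G'_def by (cases "n \<in> range (to_nat :: 'i \<Rightarrow> nat)") simp_all
  next
    fix x n assume "x \<in> ?D" "x n = -1"
    then show "G' x n \<le> 0" unfolding G'_def by (auto simp: D_def intro!: lo)
  next
    fix x n assume "x \<in> ?D" "x n = 1"
    then show "G' x n \<ge> 0" unfolding G'_def by (auto simp: D_def intro!: hi)
  qed
  then obtain x where x: "x \<in> ?D" "\<And>n. G' x n = 0" by blast
  have "G (x \<circ> to_nat) i = 0" for i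
    using x(2)[of "to_nat i"] by (simp add: G'_def)
  with x(1) show ?thesis by (intro bexI[of _ "x \<circ> to_nat"]) (auto simp: D_def)
qed

subsection \<open>Estimates in the charts\<close>

definition centre :: "int \<Rightarrow> real" where
  "centre s = (if s = 0 then 1.0225 else 1.4875)"

definition radius :: "int \<Rightarrow> real" where
  "radius s = (if s = 0 then 0.1825 else 0.1225)"

definition orient :: "int \<Rightarrow> real" where
  "orient s = (if s = 0 then 1 else -1)"

definition param :: "int \<Rightarrow> real^3 \<Rightarrow> real^3" where
  "param s v = vector [0.81 + 0.19 * v$2 - 0.03 * v$3, centre s + radius s * v$1,
     0.975 - 0.095 * v$2 - 0.06 * v$3]"

text \<open>The second and third columns of the matrix are orthogonal, along (2, 0, -1) and (-1, 0,
  -2); pairing with these directions separates the two coordinates, with factors 0.475 and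
  0.15.\<close>

definition chart :: "int \<Rightarrow> real^3 \<Rightarrow> real^3" where
  "chart s w = vector [(w$2 - centre s) / radius s,
     (2 * (w$1 - 0.81) - (w$3 - 0.975)) / 0.475,
     - (2 * (w$3 - 0.975) + (w$1 - 0.81)) / 0.15]"

text \<open>\<open>H\<close> shifts a delay recurrence; \<open>p\<close> and \<open>q\<close> are
  the entries that its first two steps bring in.\<close>

lemma H_iter4:
  "(H ^^ 4) v = (let p = 1.76 - (v$2)^2 - 0.1 * v$3; q = 1.76 - (v$1)^2 - 0.1 * v$2
     in vector [1.76 - q^2 - 0.1 * p, 1.76 - p^2 - 0.1 * v$1, q])"
  by (simp add: H_def eval_nat_numeral Let_def)

lemma chart_param: "chart s (param s v) = v"
  by (auto simp: chart_def param_def vec_eq_iff forall_3 field_simps centre_def radius_def)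

lemma param_chart: "param s (chart s w) = w"
  by (auto simp: chart_def param_def vec_eq_iff forall_3 field_simps centre_def radius_def)

lemma Ca_inv_eq: "Ca_inv = param 0"
  by (auto simp: fun_eq_iff Ca_inv_def param_def Ma_def centre_def radius_def vec_eq_iff forall_3
      matrix_vector_mult_def sum_3 algebra_simps)

lemma Cb_inv_eq: "Cb_inv = param 1"
  by (auto simp: fun_eq_iff Cb_inv_def param_def Mb_def centre_def radius_def vec_eq_iff forall_3
      matrix_vector_mult_def sum_3 algebra_simps)

lemma inv_param: "inv (param s) = chart s"
  by (metis chart_param param_chart inv_equality)

lemma mem_Bcube: "v \<in> Bcube \<longleftrightarrow> (\<forall>i. \<bar>v$i\<bar> \<le> 1)"
  by (auto simp: Bcube_def mem_box_cart abs_le_iff minus_le_iff)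

section \<open>The fourth iterate between charts\<close>

definition transition :: "int \<Rightarrow> int \<Rightarrow> real^3 \<Rightarrow> real^3" where
  "transition s s' v = chart s' ((H ^^ 4) (param s v))"

lemma square_le_secant:
  fixes x a b :: real
  assumes "a \<le> x" "x \<le> b"
  shows "x^2 \<le> (a + b) * x - a * b"
proof -
  have "(x - a) * (x - b) \<le> 0" using assms by (simp add: mult_nonneg_nonpos)
  then show ?thesis by (simp add: algebra_simps power2_eq_square)
qed

lemma tangent_le_square: "2 * a * x - a^2 \<le> (x::real)^2"
proof -
  have "0 \<le> (x - a)^2" by simp
  then show ?thesis by (simp add: algebra_simps power2_eq_square)
qed

text \<open>Over the face the image clears the target by only about 0.001 in the worst case. Interval
  bounds on \<open>p\<^sup>2\<close> lose this, so \<open>p\<^sup>2\<close> is replaced by a secant or tangent, which keeps its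
  correlation with the linear terms.\<close>

lemma transition_exit1:
  assumes v: "v \<in> Bcube" and v1: "\<bar>v$1\<bar> = 1"
  shows "orient s * v$1 * transition s s' v $ 1 > 1"
proof -
  define b c where "b = v$2" and "c = v$3"
  have bc: "-1 \<le> b" "b \<le> 1" "-1 \<le> c" "c \<le> 1"
    using v by (auto simp: mem_Bcube b_def c_def abs_le_iff minus_le_iff)
  define y where "y = centre s + radius s * v$1"
  define p where "p = 1.76 - y^2 - 0.1 * (0.975 - 0.095 * b - 0.06 * c)"
  define w where "w = 1.76 - p^2 - 0.1 * (0.81 + 0.19 * b - 0.03 * c)"
  have T: "transition s s' v $ 1 = (w - centre s') / radius s'"
    by (simp add: transition_def H_iter4 chart_def param_def Let_def w_def p_def y_def b_def c_def)
  \<comment> \<open>The second coordinate runs over [0.84, 1.205] on a and [1.365, 1.61] on b.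
    Passing 1.61 or falling below 0.84 therefore leaves either target on the correct side, so
    \<open>s'\<close> needs no case split.\<close>
  have "if orient s * v$1 > 0 then w > 1.61 else w < 0.84"
  proof -
    \<comment> \<open>The inner faces y = 1.205 and y = 1.365 give \<open>p\<close> near 0.2 in
      absolute value and large \<open>w\<close>: \<open>p^2\<close> needs an upper bound, the secant
      over an interval enclosing \<open>p\<close>. The outer faces y = 0.84 and y = 1.61 give
      \<open>p\<close> near 0.95 in absolute value and small \<open>w\<close>: a tangent bounds
      \<open>p^2\<close> from below.\<close>
    consider "s = 0" "v$1 = 1" | "s = 0" "v$1 = -1" | "s \<noteq> 0" "v$1 = 1" | "s \<noteq> 0" "v$1 = -1"
      using v1 by fastforce
    then show ?thesis
    proof cases
      case 1
      then have "y = 1.205" by (simp add: y_def centre_def radius_def)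
      then have p: "p = 1.76 - 1.205^2 - 0.1 * (0.975 - 0.095 * b - 0.06 * c)" by (simp add: p_def)
      have "p^2 \<le> (0.18 + 0.24) * p - 0.18 * 0.24"
        by (rule square_le_secant) (use bc p in \<open>simp_all add: power2_eq_square field_simps\<close>)
      with bc p 1 show ?thesis by (simp add: w_def power2_eq_square orient_def field_simps)
    next
      case 2
      then have "y = 0.84" by (simp add: y_def centre_def radius_def)
      then have p: "p = 1.76 - 0.84^2 - 0.1 * (0.975 - 0.095 * b - 0.06 * c)" by (simp add: p_def)
      have "2 * 0.94 * p - 0.94^2 \<le> p^2"
        by (rule tangent_le_square)
      with bc p 2 show ?thesis by (simp add: w_def power2_eq_square orient_def field_simps)
    next
      case 3
      then have "y = 1.61" by (simp add: y_def centre_def radius_def)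
      then have p: "p = 1.76 - 1.61^2 - 0.1 * (0.975 - 0.095 * b - 0.06 * c)" by (simp add: p_def)
      have "2 * (-0.95) * p - (-0.95)^2 \<le> p^2"
        by (rule tangent_le_square)
      with bc p 3 show ?thesis by (simp add: w_def power2_eq_square orient_def field_simps)
    next
      case 4
      then have "y = 1.365" by (simp add: y_def centre_def radius_def)
      then have p: "p = 1.76 - 1.365^2 - 0.1 * (0.975 - 0.095 * b - 0.06 * c)" by (simp add: p_def)
      have "p^2 \<le> (-0.22 + -0.18) * p - (-0.22) * (-0.18)"
        by (rule square_le_secant) (use bc p in \<open>simp_all add: power2_eq_square field_simps\<close>)
      with bc p 4 show ?thesis by (simp add: w_def power2_eq_square orient_def field_simps)
    qed
  qed
  moreover have "orient s * v$1 = 1 \<or> orient s * v$1 = -1"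
    using v1 by (auto simp: orient_def)
  moreover have "transition s s' v $ 1 > 1" if "w > 1.61"
    using that by (auto simp: T centre_def radius_def field_simps)
  moreover have "transition s s' v $ 1 < -1" if "w < 0.84"
    using that by (auto simp: T centre_def radius_def field_simps)
  ultimately show ?thesis
    by (auto split: if_splits)
qed

text \<open>The two charts differ only in the first coordinate, so \<open>s'\<close> drops out of
  the other two, and \<open>s\<close> enters only through \<open>y\<close>, which stays in the hull
  [0.84, 1.61]. The constants of the chart make the third coordinate a perfect square plus a small
  term in \<open>p\<close>.\<close>

lemma transition_coords:
  assumes v: "v \<in> Bcube"
  obtains x y p q where "x = 0.81 + 0.19 * v$2 - 0.03 * v$3" "0.84 \<le> y" "y \<le> 1.61" "\<bar>p\<bar> \<le> 0.975"
    "q = 1.76 - x^2 - 0.1 * y"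
    "transition s s' v $ 2 = (2.875 - 2 * q^2 - q - 0.2 * p) / 0.475"
    "transition s s' v $ 3 = ((q - 1)^2 + 0.1 * p) / 0.15"
proof -
  have bc: "\<bar>v$1\<bar> \<le> 1" "\<bar>v$2\<bar> \<le> 1" "\<bar>v$3\<bar> \<le> 1" using v by (auto simp: mem_Bcube)
  define x where "x = 0.81 + 0.19 * v$2 - 0.03 * v$3"
  define y where "y = centre s + radius s * v$1"
  define z where "z = 0.975 - 0.095 * v$2 - 0.06 * v$3"
  define p where "p = 1.76 - y^2 - 0.1 * z"
  define q where "q = 1.76 - x^2 - 0.1 * y"
  have y: "0.84 \<le> y" "y \<le> 1.61" using bc by (auto simp: y_def centre_def radius_def abs_le_iff)
  have z: "0.82 \<le> z" "z \<le> 1.13" using bc by (auto simp: z_def abs_le_iff)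
  have "y^2 \<le> 1.61^2" "0.84^2 \<le> y^2" using y by (auto intro!: power_mono)
  with z have "p \<le> 0.975" "-0.975 \<le> p" by (simp_all add: p_def power2_eq_square field_simps)
  then have p: "\<bar>p\<bar> \<le> 0.975" by simp
  have "param s v = vector [x, y, z]" by (simp add: param_def x_def y_def z_def)
  then have H4: "(H ^^ 4) (param s v) = vector [1.76 - q^2 - 0.1 * p, 1.76 - p^2 - 0.1 * x, q]"
    by (simp add: H_iter4 Let_def p_def q_def)
  have "transition s s' v $ 2 = (2.875 - 2 * q^2 - q - 0.2 * p) / 0.475"
    "transition s s' v $ 3 = ((q - 1)^2 + 0.1 * p) / 0.15"
    unfolding transition_def H4 by (simp_all add: chart_def field_simps power2_eq_square)
  with that y p x_def q_def show ?thesis by blast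
qed

text \<open>The sign of \<open>v$2\<close> decides whether \<open>q\<close> is at most 0.75 or at
  least 1.17, and the second coordinate of the image decreases in positive \<open>q\<close>. The
  margins are wide, so interval bounds suffice here.\<close>

lemma transition_exit2:
  assumes v: "v \<in> Bcube" and v2: "\<bar>v$2\<bar> = 1"
  shows "v$2 * transition s s' v $ 2 > 1"
proof -
  obtain x y p q where *: "x = 0.81 + 0.19 * v$2 - 0.03 * v$3" "0.84 \<le> y" "y \<le> 1.61" "\<bar>p\<bar> \<le> 0.975"
    "q = 1.76 - x^2 - 0.1 * y"
    "transition s s' v $ 2 = (2.875 - 2 * q^2 - q - 0.2 * p) / 0.475"
    using transition_coords[OF v] .
  have c: "\<bar>v$3\<bar> \<le> 1" using v by (auto simp: mem_Bcube)
  consider "v$2 = 1" | "v$2 = -1" using v2 by linarith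
  then show ?thesis
  proof cases
    case 1
    then have "0.97 \<le> x" "x \<le> 1.03" using c *(1) by auto
    then have "0.97^2 \<le> x^2" "x^2 \<le> 1.03^2" by (auto intro!: power_mono)
    then have q: "0.5 \<le> q" "q \<le> 0.75" using *(2,3) by (simp_all add: *(5) power2_eq_square field_simps)
    then have "q^2 \<le> 0.75^2" by (intro power_mono) auto
    then have "2.875 - 2 * q^2 - q - 0.2 * p > 0.475"
      using q *(4) by (simp add: power2_eq_square abs_le_iff field_simps)
    then show ?thesis using 1 by (simp add: *(6) field_simps)
  next
    case 2
    then have "0.59 \<le> x" "x \<le> 0.65" using c *(1) by auto
    then have "x^2 \<le> 0.65^2" by (auto intro!: power_mono)
    then have q: "1.17 \<le> q" using *(2,3) by (simp add: *(5) power2_eq_square field_simps)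
    then have "1.17^2 \<le> q^2" by (intro power_mono) auto
    then have "2.875 - 2 * q^2 - q - 0.2 * p < -0.475"
      using q *(4) by (simp add: power2_eq_square abs_le_iff field_simps)
    then show ?thesis using 2 by (simp add: *(6) field_simps)
  qed
qed

text \<open>The bound on the second coordinate confines \<open>2 * q^2 + q\<close>, hence
  \<open>q\<close>, to a neighbourhood of 1. The square is then at most 0.0324 and the term in
  \<open>p\<close> at most 0.0975 in absolute value, together below 0.15.\<close>

lemma transition_entry:
  assumes v: "v \<in> Bcube" and T2: "\<bar>transition s s' v $ 2\<bar> \<le> 1"
  shows "\<bar>transition s s' v $ 3\<bar> < 1"
proof -
  obtain x y p q where *: "x = 0.81 + 0.19 * v$2 - 0.03 * v$3" "0.84 \<le> y" "y \<le> 1.61" "\<bar>p\<bar> \<le> 0.975"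
    "q = 1.76 - x^2 - 0.1 * y"
    "transition s s' v $ 2 = (2.875 - 2 * q^2 - q - 0.2 * p) / 0.475"
    "transition s s' v $ 3 = ((q - 1)^2 + 0.1 * p) / 0.15"
    using transition_coords[OF v] .
  have c: "\<bar>v$2\<bar> \<le> 1" "\<bar>v$3\<bar> \<le> 1" using v by (auto simp: mem_Bcube)
  then have "0.59 \<le> x" "x \<le> 1.03" using *(1) by auto
  then have "x^2 \<le> 1.03^2" by (auto intro!: power_mono)
  \<comment> \<open>This excludes the negative branch of the quadratic inequality for
    \<open>q\<close>.\<close>
  then have q0: "0.5 \<le> q" using *(2,3) by (simp add: *(5) power2_eq_square field_simps)
  have Q: "2 * q^2 + q \<le> 3.545" "2.205 \<le> 2 * q^2 + q"
    using T2 *(4) unfolding *(6) abs_le_iff by (simp_all add: field_simps)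
  have "q \<le> 1.13"
  proof (rule ccontr)
    assume "\<not> ?thesis"
    then have "1.13^2 \<le> q^2" by (intro power_mono) auto
    with \<open>\<not> ?thesis\<close> Q(1) show False by (simp add: power2_eq_square field_simps)
  qed
  moreover have "0.82 \<le> q"
  proof (rule ccontr)
    assume "\<not> ?thesis"
    then have "q^2 \<le> 0.82^2" using q0 by (intro power_mono) auto
    with \<open>\<not> ?thesis\<close> Q(2) show False by (simp add: power2_eq_square field_simps)
  qed
  ultimately have "q - 1 \<le> 0.18" "-0.18 \<le> q - 1" by simp_all
  then have "\<bar>q - 1\<bar> \<le> 0.18" by (simp only: abs_le_iff) simp
  then have "\<bar>q - 1\<bar>^2 \<le> 0.18^2" by (intro power_mono) auto
  then have "(q - 1)^2 \<le> 0.0324" by (simp add: power2_eq_square)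
  moreover have p: "p \<le> 0.975" "-0.975 \<le> p" using *(4) by simp_all
  ultimately have "(q - 1)^2 + 0.1 * p < 0.15" by simp
  moreover have "-0.15 < 0 + 0.1 * p" using p by simp
  then have "-0.15 < (q - 1)^2 + 0.1 * p" by (rule less_le_trans) simp
  ultimately show ?thesis unfolding *(7) by simp
qed

section \<open>Continuity of the map and the charts\<close>

lemma continuous_on_vector3 [continuous_intros]:
  fixes f g h :: "'a::topological_space \<Rightarrow> real"
  assumes "continuous_on S f" "continuous_on S g" "continuous_on S h"
  shows "continuous_on S (\<lambda>x. vector [f x, g x, h x] :: real^3)"
proof -
  have "continuous_on S (\<lambda>x. (vector [f x, g x, h x] :: real^3) $ i)" for i
    using exhaust_3[of i] assms by auto
  from continuous_on_vec_lambda[where f = "\<lambda>i x. (vector [f x, g x, h x] :: real^3) $ i", OF this]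
  show ?thesis by simp
qed

lemma continuous_on_param: "continuous_on S (param s)"
  unfolding param_def by (intro continuous_intros)

lemma continuous_on_chart: "continuous_on S (chart s)"
  unfolding chart_def by (intro continuous_intros) (auto simp: radius_def)

lemma continuous_on_H: "continuous_on S H"
  unfolding H_def by (intro continuous_intros)

subsection \<open>The covering relations\<close>

definition supp :: "int \<Rightarrow> (real^3) set" where
  "supp s = param s ` Bcube"

section \<open>Identification of real^3 with real^2 x real^1, and the unit cubes\<close>

definition merge3 :: "(real^2) \<times> (real^1) \<Rightarrow> real^3" where
  "merge3 p = vector [fst p $ 1, fst p $ 2, snd p $ 1]"

lemma split3_merge3: "split3 (merge3 p) = p"
  by (auto simp: split3_def merge3_def prod_eq_iff vec_eq_iff forall_2 forall_1)

lemma merge3_split3: "merge3 (split3 v) = v"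
  by (auto simp: split3_def merge3_def vec_eq_iff forall_3)

lemma One_nth: "(One :: real^'n) $ i = 1"
proof -
  have "axis i (1::real) \<in> (Basis :: (real^'n) set)" by (simp add: axis_in_Basis_iff)
  then have "(One :: real^'n) \<bullet> axis i 1 = 1" 
    by (simp add: inner_sum_left inner_Basis)
  then show ?thesis by (simp add: inner_axis)
qed

lemma mem_closed_cube: "(x::real^'n) \<in> closed_cube \<longleftrightarrow> (\<forall>i. \<bar>x$i\<bar> \<le> 1)"
  unfolding closed_cube_def mem_box_cart vector_uminus_component One_nth
  by (auto simp: abs_le_iff minus_le_iff)

lemma mem_open_cube: "(x::real^'n) \<in> open_cube \<longleftrightarrow> (\<forall>i. \<bar>x$i\<bar> < 1)"
  unfolding open_cube_def mem_box_cart vector_uminus_component One_nth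
  by (auto simp: abs_less_iff minus_less_iff)

lemma frontier_open_cube:
  "frontier (open_cube :: (real^'n) set) = {x. (\<forall>i. \<bar>x$i\<bar> \<le> 1) \<and> (\<exists>i. \<bar>x$i\<bar> = 1)}"
proof -
  have "0 \<in> (open_cube :: (real^'n) set)" by (simp add: mem_open_cube)
  then have "closure (open_cube :: (real^'n) set) = closed_cube"
    unfolding open_cube_def closed_cube_def by (intro closure_box) auto
  moreover have "interior (open_cube :: (real^'n) set) = open_cube"
    unfolding open_cube_def by (intro interior_open open_box)
  ultimately have "frontier (open_cube :: (real^'n) set) = closed_cube - open_cube"
    by (simp add: frontier_def)
  then show ?thesis
    by (auto simp: mem_closed_cube mem_open_cube not_less) (metis order_antisym, metis less_irrefl)
qed

lemma mem_Nc: "p \<in> Nc \<longleftrightarrow> merge3 p \<in> Bcube"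
  by (cases p) (auto simp: Nc_def mem_closed_cube mem_Bcube merge3_def forall_1 forall_2 forall_3)

lemma continuous_on_split3: "continuous_on S split3"
proof -
  have "continuous_on S (\<lambda>v. (vector [v$1, v$2] :: real^2) $ i)" for i
    using exhaust_2[of i] by (elim disjE) (simp_all add: continuous_on_component)
  from continuous_on_vec_lambda[where f = "\<lambda>i v. (vector [v$1, v$2] :: real^2) $ i", OF this]
  have 1: "continuous_on S (\<lambda>v. vector [v$1, v$2] :: real^2)" by simp
  have "continuous_on S (\<lambda>v. (vector [v$3] :: real^1) $ i)" for i
    by (subst num1_eq1[of i]) (simp add: continuous_on_component)
  from continuous_on_vec_lambda[where f = "\<lambda>i v. (vector [v$3] :: real^1) $ i", OF this]
  have 2: "continuous_on S (\<lambda>v. vector [v$3] :: real^1)" by simp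
  show ?thesis unfolding split3_def using 1 2 by (intro continuous_on_Pair)
qed

lemma continuous_on_merge3: "continuous_on S merge3"
  unfolding merge3_def by (intro continuous_intros)

section \<open>The supports as h-sets\<close>

lemma compact_supp: "compact (supp s)"
  unfolding supp_def Bcube_def
  by (intro compact_continuous_image continuous_on_param compact_cbox)

lemma inv_split3_chart: "inv (split3 \<circ> chart s) = param s \<circ> merge3"
  by (rule inv_equality) (simp_all add: merge3_split3 split3_merge3 chart_param param_chart)

lemma is_hset_supp: "is_hset (supp s) (split3 \<circ> chart s)"
proof -
  have "homeomorphism UNIV UNIV (split3 \<circ> chart s) (param s \<circ> merge3)"
    unfolding homeomorphism_def
  proof (intro conjI)
    show "continuous_on UNIV (split3 \<circ> chart s)" "continuous_on UNIV (param s \<circ> merge3)"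
      by (intro continuous_on_compose continuous_on_split3 continuous_on_chart
          continuous_on_param continuous_on_merge3)+
    show "(split3 \<circ> chart s) ` UNIV = UNIV"
      by (metis UNIV_I comp_apply chart_param split3_merge3 surj_def)
    show "(param s \<circ> merge3) ` UNIV = UNIV"
      by (metis UNIV_I comp_apply param_chart merge3_split3 surj_def)
  qed (simp_all add: merge3_split3 split3_merge3 chart_param param_chart)
  moreover have "(split3 \<circ> chart s) ` supp s = Nc"
  proof -
    have "(split3 \<circ> chart s) ` supp s = split3 ` Bcube"
      by (auto simp: supp_def image_image chart_param)
    also have "\<dots> = Nc"
      by (auto simp: mem_Nc merge3_split3) (metis image_eqI mem_Nc split3_merge3)
    finally show ?thesis .
  qed
  ultimately show ?thesis
    using compact_supp by (auto simp: is_hset_def)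
qed

lemma continuous_on_funpow:
  fixes F :: "'a::topological_space \<Rightarrow> 'a"
  assumes "continuous_on UNIV F"
  shows "continuous_on S (F ^^ n)"
proof (induction n)
  case (Suc n)
  then show ?case
    unfolding funpow.simps
    by (rule continuous_on_compose) (rule continuous_on_subset[OF assms], simp)
qed (simp add: id_def)

lemma continuous_on_H4: "continuous_on S (H ^^ 4)"
  by (intro continuous_on_funpow continuous_on_H)

lemma continuous_on_transition: "continuous_on S (transition s s')"
proof -
  have "continuous_on S (chart s' \<circ> (H ^^ 4) \<circ> param s)"
    by (intro continuous_on_compose continuous_on_H4 continuous_on_chart continuous_on_param)
  then show ?thesis by (simp add: transition_def[abs_def] o_def)
qed

text \<open>After multiplication by the sign \<open>e\<close> both endpoints, \<open>e * q\<close>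
  and 2, exceed 1, hence so does every point between them.\<close>

lemma abs_convex_comb_gt_one:
  fixes e q b :: real
  assumes e: "\<bar>e\<bar> = 1" and q: "e * q > 1" and b: "0 \<le> b" "b \<le> 1"
  shows "\<bar>(1 - b) * q + b * (2 * e)\<bar> > 1"
proof -
  have ee: "e * e = 1" using e by (metis abs_mult_self_eq mult_1)
  have "0 < (1 - b) * (e * q - 1) + b"
    using q b by (cases "b = 0") (auto intro: add_nonneg_pos)
  also have "\<dots> = e * ((1 - b) * q + b * (2 * e)) - 1 + b * 2 * (1 - e * e)"
    by (simp add: algebra_simps)
  finally have "1 < e * ((1 - b) * q + b * (2 * e))" using ee by simp
  also have "\<dots> \<le> \<bar>e * ((1 - b) * q + b * (2 * e))\<bar>" by simp
  finally show ?thesis using e by (simp add: abs_mult)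
qed

text \<open>The homotopy first retracts the contracted third coordinate to 0 while the expanding
  coordinates are untouched, and only then deforms these linearly; a single linear homotopy
  need not keep the third coordinate inside, since the entry estimate needs the second
  coordinate of the image in [-1,1].\<close>

lemma covers_supp: "covers (supp s) (split3 \<circ> chart s) (H ^^ 4) (supp s') (split3 \<circ> chart s')"
proof -
  define A :: "real^2 \<Rightarrow> real^2" where "A x = vector [2 * (orient s * x$1), 2 * x$2]" for x
  \<comment> \<open>\<open>\<alpha>\<close> reaches 1 at time 1/2, exactly when
    \<open>\<beta>\<close> leaves 0. So at each time either the expanding coordinates are still
    those of the image, and the entry estimate applies, or the third coordinate is already
    0.\<close>
  define \<alpha> \<beta> :: "real \<Rightarrow> real" where "\<alpha> t = min 1 (2 * t)" and "\<beta> t = max 0 (2 * t - 1)" for t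
  define k :: "real \<times> (real^2) \<times> (real^1) \<Rightarrow> real^3" where
    "k = (\<lambda>(t, p). let q = transition s s' (merge3 p); v = merge3 p in
      vector [(1 - \<beta> t) * q$1 + \<beta> t * (2 * (orient s * v$1)),
        (1 - \<beta> t) * q$2 + \<beta> t * (2 * v$2), (1 - \<alpha> t) * q$3])"
  have merge: "merge3 (x, y) $ 1 = x$1" "merge3 (x, y) $ 2 = x$2" for x y
    by (simp_all add: merge3_def)
  have or: "\<bar>orient s\<bar> = 1" by (simp add: orient_def)
  have bt: "0 \<le> \<beta> t" "\<beta> t \<le> 1" if "t \<in> {0..1}" for t
    using that by (auto simp: \<beta>_def)
  have exit: "\<bar>fst (split3 (k (t, p))) $ i\<bar> > 1"
    if t: "t \<in> {0..1}" and p: "merge3 p \<in> Bcube" and i: "\<bar>fst p $ i\<bar> = 1" for t p i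
  proof -
    consider "i = 1" | "i = 2" using exhaust_2 by blast
    then show ?thesis
    proof cases
      case 1
      then have v1: "\<bar>merge3 p $ 1\<bar> = 1" using i by (simp add: merge3_def)
      from abs_convex_comb_gt_one[OF _ transition_exit1[OF p v1] bt[OF t]] show ?thesis
        using or v1 1 by (simp add: k_def split3_def Let_def abs_mult)
    next
      case 2
      then have v2: "\<bar>merge3 p $ 2\<bar> = 1" using i by (simp add: merge3_def)
      from abs_convex_comb_gt_one[OF v2 transition_exit2[OF p v2] bt[OF t]] show ?thesis
        using 2 by (simp add: k_def split3_def Let_def)
    qed
  qed
  have entry: "\<bar>k (t, p) $ 3\<bar> < 1"
    if t: "t \<in> {0..1}" and p: "merge3 p \<in> Bcube" and k2: "\<bar>k (t, p) $ 2\<bar> \<le> 1" for t p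
  proof (cases "t \<le> 1/2")
    case True
    then have "\<beta> t = 0" "0 \<le> \<alpha> t" "\<alpha> t \<le> 1" using t by (auto simp: \<beta>_def \<alpha>_def)
    moreover from this k2 have "\<bar>transition s s' (merge3 p) $ 3\<bar> < 1"
      by (intro transition_entry[OF p]) (simp add: k_def Let_def)
    moreover have "\<bar>1 - \<alpha> t\<bar> * \<bar>transition s s' (merge3 p) $ 3\<bar> \<le> \<bar>transition s s' (merge3 p) $ 3\<bar>"
      using \<open>0 \<le> \<alpha> t\<close> \<open>\<alpha> t \<le> 1\<close> by (intro mult_left_le_one_le) auto
    ultimately show ?thesis by (simp add: k_def Let_def abs_mult)
  next
    case False
    then have "\<alpha> t = 1" by (simp add: \<alpha>_def)
    then show ?thesis by (simp add: k_def Let_def)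
  qed
  have ck: "continuous_on ({0..1} \<times> Nc) k"
    unfolding k_def case_prod_unfold Let_def \<alpha>_def \<beta>_def
    by (intro continuous_intros continuous_on_compose2[OF continuous_on_transition]
        continuous_on_compose2[OF continuous_on_merge3]) auto
  show ?thesis
    unfolding covers_def
  proof (intro conjI is_hset_supp continuous_on_H4 exI[of _ "split3 \<circ> k"])
    show "continuous_on ({0..1} \<times> Nc) (split3 \<circ> k)"
      by (intro continuous_on_compose ck continuous_on_split3)
    show "\<forall>p\<in>Nc. (split3 \<circ> k) (0, p) =
        (split3 \<circ> chart s') ((H ^^ 4) (inv (split3 \<circ> chart s) p))"
      by (auto simp: inv_split3_chart k_def Let_def \<alpha>_def \<beta>_def transition_def split3_def)
    show "\<forall>t\<in>{0..1}. \<forall>p\<in>Nc_minus. (split3 \<circ> k) (t, p) \<notin> Nc"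
    proof (intro ballI notI)
      fix t :: real and p assume t: "t \<in> {0..1}" and p: "p \<in> (Nc_minus :: ((real^2) \<times> (real^1)) set)"
        and N: "(split3 \<circ> k) (t, p) \<in> Nc"
      from p obtain i where i: "\<bar>fst p $ i\<bar> = 1" and pN: "p \<in> Nc"
        by (auto simp: Nc_minus_def Nc_def frontier_open_cube mem_closed_cube)
      from N have "\<bar>fst (split3 (k (t, p))) $ i\<bar> \<le> 1"
        by (auto simp: Nc_def mem_closed_cube mem_Times_iff)
      with exit[OF t _ i] pN show False by (simp add: mem_Nc)
    qed
    show "\<forall>t\<in>{0..1}. \<forall>p\<in>Nc. (split3 \<circ> k) (t, p) \<notin> Nc_plus"
    proof (intro ballI notI)
      fix t :: real and p assume t: "t \<in> {0..1}" and p: "p \<in> (Nc :: ((real^2) \<times> (real^1)) set)"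
        and N: "(split3 \<circ> k) (t, p) \<in> Nc_plus"
      from N have "\<bar>k (t, p) $ 2\<bar> \<le> 1" "\<bar>k (t, p) $ 3\<bar> = 1"
        by (auto simp: Nc_plus_def split3_def frontier_open_cube mem_closed_cube forall_1 forall_2
            mem_Times_iff)
      moreover from p have "merge3 p \<in> Bcube" by (simp add: mem_Nc)
      ultimately show False using entry[OF t, of p] by simp
    qed
    show "\<exists>A. linear A \<and>
        (\<forall>x\<in>closed_cube. \<forall>y\<in>closed_cube. (split3 \<circ> k) (1, (x, y)) = (A x, 0)) \<and>
        A ` frontier open_cube \<subseteq> - open_cube"
    proof (intro exI[of _ A] conjI)
      show "linear A" by (auto simp: A_def linear_iff vec_eq_iff forall_2 algebra_simps)
      show "\<forall>x\<in>closed_cube. \<forall>y\<in>closed_cube. (split3 \<circ> k) (1, (x, y)) = (A x, 0)"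
        by (auto simp: k_def Let_def \<alpha>_def \<beta>_def split3_def A_def merge vec_eq_iff forall_1)
      show "A ` frontier open_cube \<subseteq> - open_cube"
      proof clarify
        fix x :: "real^2" assume x: "x \<in> frontier open_cube" and A: "A x \<in> open_cube"
        from x obtain i where "\<bar>x$i\<bar> = 1" by (auto simp: frontier_open_cube)
        then have "\<bar>A x $ i\<bar> = 2"
          using exhaust_2[of i] or by (auto simp: A_def abs_mult)
        with A show False by (auto simp: mem_open_cube dest: spec[of _ i])
      qed
    qed
  qed
qed

subsection \<open>Symbolic dynamics\<close>

text \<open>Each unknown is paired with the equation whose sign it controls: an expanding coordinate
  at time \<open>i\<close> with the step from \<open>i\<close> to \<open>i + 1\<close>, the
  contracting one with the step from \<open>i - 1\<close> to \<open>i\<close>. This covers every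
  equation of the orbit once.\<close>

lemma transition_orbit_exists:
  fixes l :: "int \<Rightarrow> int"
  shows "\<exists>v. (\<forall>i. v i \<in> Bcube) \<and> (\<forall>i. transition (l i) (l (i + 1)) (v i) = v (i + 1))"
proof -
  define pt :: "(int \<times> 3 \<Rightarrow> real) \<Rightarrow> int \<Rightarrow> real^3" where "pt X i = (\<chi> k. X (i, k))" for X i
  define T where "T i = transition (l i) (l (i + 1))" for i
  define G :: "(int \<times> 3 \<Rightarrow> real) \<Rightarrow> int \<times> 3 \<Rightarrow> real" where
    "G X = (\<lambda>(i, k).
      if k = 1 then orient (l i) * (T i (pt X i) $ 1 - X (i + 1, 1))
      else if k = 2 then T i (pt X i) $ 2 - X (i + 1, 2)
      else X (i, 3) - max (-1) (min 1 (T (i - 1) (pt X (i - 1)) $ 3)))" for X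
  let ?D = "{X :: int \<times> 3 \<Rightarrow> real. \<forall>i. X i \<in> {-1..1}}"
  have ptB: "pt X i \<in> Bcube" if "X \<in> ?D" for X i
    using that by (auto simp: pt_def mem_Bcube abs_le_iff minus_le_iff)
  have bound: "\<bar>X p\<bar> \<le> 1" if "X \<in> ?D" for X p
  proof -
    from that have "X p \<in> {-1..1}" by blast
    then show ?thesis by (simp add: abs_le_iff minus_le_iff)
  qed
  have coord: "continuous_on S (\<lambda>X :: int \<times> 3 \<Rightarrow> real. X p)" for S p
    by (rule continuous_on_subset[OF continuous_on_product_coordinates]) simp
  have "continuous_on S (\<lambda>X. pt X i)" for S i
    unfolding pt_def by (intro continuous_on_vec_lambda coord)
  then have cT: "continuous_on S (\<lambda>X. T i (pt X i) $ k)" for S i k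
    unfolding T_def
    by (intro continuous_on_component continuous_on_compose2[OF continuous_on_transition[of UNIV]]) auto
  have k3: "k = 3" if "k \<noteq> 1" "k \<noteq> 2" for k :: 3
    using exhaust_3[of k] that by blast
  have "\<exists>X\<in>?D. \<forall>p. G X p = 0"
  proof (rule poincare_miranda_countable)
    fix p :: "int \<times> 3"
    obtain i k where p: "p = (i, k)" by (cases p)
    show "continuous_on ?D (\<lambda>X. G X p)"
      unfolding G_def p case_prod_conv
      by (cases "k = 1"; cases "k = 2") (simp_all, (intro continuous_intros cT coord)+)
  next
    fix X and p :: "int \<times> 3" assume X: "X \<in> ?D" and Xp: "X p = -1"
    obtain i k where p: "p = (i, k)" by (cases p)
    have b: "\<bar>X (i + 1, k)\<bar> \<le> 1" using bound[OF X] .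
    consider "k = 1" | "k = 2" | "k = 3" using exhaust_3 by blast
    then show "G X p \<le> 0"
    proof cases
      case 1
      with Xp p have "pt X i $ 1 = -1" by (simp add: pt_def)
      with transition_exit1[OF ptB[OF X, of i], of "l i" "l (i + 1)"] b 1 show ?thesis
        by (auto simp: G_def p T_def orient_def abs_le_iff split: if_splits)
    next
      case 2
      with Xp p have "pt X i $ 2 = -1" by (simp add: pt_def)
      with transition_exit2[OF ptB[OF X, of i], of "l i" "l (i + 1)"] b 2 show ?thesis
        by (auto simp: G_def p T_def abs_le_iff)
    next
      case 3
      with Xp p show ?thesis by (simp add: G_def)
    qed
  next
    fix X and p :: "int \<times> 3" assume X: "X \<in> ?D" and Xp: "X p = 1"
    obtain i k where p: "p = (i, k)" by (cases p)
    have b: "\<bar>X (i + 1, k)\<bar> \<le> 1" using bound[OF X] .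
    consider "k = 1" | "k = 2" | "k = 3" using exhaust_3 by blast
    then show "G X p \<ge> 0"
    proof cases
      case 1
      with Xp p have "pt X i $ 1 = 1" by (simp add: pt_def)
      with transition_exit1[OF ptB[OF X, of i], of "l i" "l (i + 1)"] b 1 show ?thesis
        by (auto simp: G_def p T_def orient_def abs_le_iff split: if_splits)
    next
      case 2
      with Xp p have "pt X i $ 2 = 1" by (simp add: pt_def)
      with transition_exit2[OF ptB[OF X, of i], of "l i" "l (i + 1)"] b 2 show ?thesis
        by (auto simp: G_def p T_def abs_le_iff)
    next
      case 3
      with Xp p show ?thesis by (simp add: G_def)
    qed
  qed
  then obtain X where X: "X \<in> ?D" and G0: "\<And>p. G X p = 0" by blast
  have "T i (pt X i) = pt X (i + 1)" for i
  proof -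
    have 1: "T i (pt X i) $ 1 = X (i + 1, 1)"
      using G0[of "(i, 1)"] by (auto simp: G_def orient_def split: if_splits)
    have 2: "T i (pt X i) $ 2 = X (i + 1, 2)"
      using G0[of "(i, 2)"] by (auto simp: G_def)
    \<comment> \<open>The equation for the second coordinate supplies the hypothesis of the entry
      estimate, which removes the truncation. The contracting equation of this step carries the
      index \<open>i + 1\<close>.\<close>
    then have "\<bar>T i (pt X i) $ 3\<bar> < 1"
      unfolding T_def using bound[OF X] by (intro transition_entry[OF ptB[OF X]]) simp
    then have 3: "T i (pt X i) $ 3 = X (i + 1, 3)"
      using G0[of "(i + 1, 3)"] by (auto simp: G_def)
    show ?thesis using 1 2 3 by (simp add: vec_eq_iff forall_3 pt_def)
  qed
  with ptB[OF X] show ?thesis unfolding T_def by blast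
qed

section \<open>Integer iterates of a bijection\<close>

lemma iter_int_Suc:
  assumes "bij F"
  shows "iter_int F (k + 1) x = F (iter_int F k x)"
proof (cases "0 \<le> k")
  case True
  then show ?thesis by (simp add: iter_int_def nat_add_distrib)
next
  case False
  then have "nat (- k) = Suc (nat (- (k + 1)))" by simp
  with False assms show ?thesis
    \<comment> \<open>At \<open>k = -1\<close> the successor falls into the nonnegative branch of
      \<open>iter_int\<close>.\<close>
    by (cases "k = -1") (auto simp: iter_int_def bij_is_surj surj_f_inv_f)
qed

text \<open>Forward times follow from the recursion, backward times from injectivity of
  \<open>F\<close>. Identities between integer iterates thus reduce to checking that a sequence is
  an orbit.\<close>

lemma iter_int_unique:
  assumes F: "bij F" and w: "\<And>k. w (k + 1) = F (w k)"
  shows "iter_int F k (w 0) = w k"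
proof (induction k rule: int_induct[where k = 0])
  case base
  show ?case by (simp add: iter_int_def)
next
  case (step1 i)
  then show ?case by (simp add: iter_int_Suc[OF F] w)
next
  case (step2 i)
  have "F (iter_int F (i - 1) (w 0)) = F (w (i - 1))"
    using step2 iter_int_Suc[OF F, of "i - 1" "w 0"] w[of "i - 1"] by simp
  then show ?case using F by (simp add: bij_is_inj inj_eq)
qed

lemma iter_int_add_nat:
  assumes "bij F"
  shows "iter_int F (k + int n) x = (F ^^ n) (iter_int F k x)"
proof (induction n)
  case (Suc n)
  have "k + int (Suc n) = (k + int n) + 1" by simp
  then have "iter_int F (k + int (Suc n)) x = F (iter_int F (k + int n) x)"
    by (simp only: iter_int_Suc[OF assms])
  with Suc show ?case by simp
qed simp

lemma iter_int_funpow: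
  assumes F: "bij F"
  shows "iter_int (F ^^ n) k x = iter_int F (int n * k) x"
proof -
  have "iter_int F (int n * (k + 1)) x = (F ^^ n) (iter_int F (int n * k) x)" for k
    using iter_int_add_nat[OF F, of "int n * k" n x] by (simp add: distrib_left)
  from iter_int_unique[OF bij_fn[OF F], of "\<lambda>k. iter_int F (int n * k) x", OF this]
  show ?thesis by (simp add: iter_int_def)
qed

lemma iter_int_shift:
  assumes F: "bij F"
  shows "iter_int F k (F x) = iter_int F (k + 1) x"
proof -
  have "iter_int F (0 + 1) x = F x"
    by (simp only: iter_int_Suc[OF F]) (simp add: iter_int_def)
  with iter_int_unique[OF F, of "\<lambda>k. iter_int F (k + 1) x" k, OF iter_int_Suc[OF F]]
  show ?thesis by simp
qed

section \<open>The inverse of \<open>H\<close> and separation of the supports\<close>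

definition H_inverse :: "real^3 \<Rightarrow> real^3" where
  "H_inverse w = vector [w$2, w$3, 10 * (1.76 - (w$3)^2 - w$1)]"

lemma H_H_inverse: "H (H_inverse w) = w"
  by (simp add: H_def H_inverse_def vec_eq_iff forall_3 field_simps)

lemma H_inverse_H: "H_inverse (H v) = v"
  by (simp add: H_def H_inverse_def vec_eq_iff forall_3 field_simps)

lemma bij_H: "bij H"
  by (metis H_H_inverse H_inverse_H bijI')

lemma inv_H: "inv H = H_inverse"
  by (metis H_H_inverse H_inverse_H inv_equality ext)

lemma continuous_on_iter_int_H: "continuous_on S (iter_int H k)"
proof -
  have "continuous_on S (H_inverse ^^ n)" for n
    by (intro continuous_on_funpow) (unfold H_inverse_def, intro continuous_intros)
  moreover have "continuous_on S (H ^^ n)" for n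
    by (intro continuous_on_funpow continuous_on_H)
  ultimately show ?thesis by (simp add: iter_int_def inv_H)
qed

text \<open>The ranges [0.84, 1.205] and [1.365, 1.61] of the second coordinate are separated by
  1.3.\<close>

lemma supp_disjoint: "supp 0 \<inter> supp 1 = {}"
proof -
  have "(w$2 < 1.3) = (s = 0)" if w: "w \<in> supp s" for w s
  proof -
    obtain v where "w = param s v" "\<bar>v$1\<bar> \<le> 1" using w by (auto simp: supp_def mem_Bcube)
    then show ?thesis by (simp add: param_def centre_def radius_def abs_le_iff field_simps)
  qed
  from this[of _ 0] this[of _ 1] show ?thesis by auto
qed

section \<open>The metric on the symbol space\<close>

lemma summable_on_pow_abs_int: "(\<lambda>n::int. 1 / 2 ^ nat \<bar>n\<bar> :: real) summable_on UNIV"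
proof -
  have "(\<lambda>n. (1 / 2) ^ n :: real) summable_on (UNIV :: nat set)"
    by (intro norm_summable_imp_summable_on) (simp add: summable_geometric)
  then have "(\<lambda>n. 1 / 2 ^ nat \<bar>n\<bar> :: real) summable_on range int"
    "(\<lambda>n. 1 / 2 ^ nat \<bar>n\<bar> :: real) summable_on range (\<lambda>n. - int n)"
    by (subst summable_on_reindex; simp add: inj_on_def o_def power_one_over)+
  then have "(\<lambda>n. 1 / 2 ^ nat \<bar>n\<bar> :: real) summable_on (range int \<union> range (\<lambda>n. - int n))"
    by (rule summable_on_union)
  moreover have "range int \<union> range (\<lambda>n. - int n) = UNIV"
    by (auto intro: int_cases2)
  ultimately show ?thesis by simp
qed

text \<open>On 0-1 sequences the terms of the distance are dominated by a summable weight. Agreement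
  on a finite set carrying all but \<open>e / 2\<close> of its mass leaves only the tail; the
  halving makes the final inequality strict.\<close>

lemma sigma_dist_small:
  assumes "e > 0"
  obtains F where "finite F"
    "\<And>l l'. \<lbrakk>l \<in> Sigma2; l' \<in> Sigma2; \<forall>n\<in>F. l n = l' n\<rbrakk> \<Longrightarrow> sigma_dist l l' < e"
proof -
  define W where "W = (\<lambda>n::int. 1 / 2 ^ nat \<bar>n\<bar> :: real)"
  have W: "W summable_on UNIV" using summable_on_pow_abs_int by (simp add: W_def)
  from infsum_finite_approximation[OF W, of "e/2"] assms obtain F where
    F: "finite F" "dist (sum W F) (infsum W UNIV) \<le> e / 2" by auto
  have tail: "W summable_on -F" using W by (rule summable_on_subset_banach) simp
  have "infsum W (- F) = infsum W UNIV - sum W F"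
    using infsum_Diff[of W UNIV F] W F(1) by (simp add: Compl_eq_Diff_UNIV)
  with F(2) have le: "infsum W (- F) \<le> e / 2" unfolding dist_real_def by linarith
  have "sigma_dist l l' < e" if l: "l \<in> Sigma2" "l' \<in> Sigma2" "\<forall>n\<in>F. l n = l' n" for l l'
  proof -
    let ?d = "\<lambda>n. real_of_int \<bar>l n - l' n\<bar> / 2 ^ nat \<bar>n\<bar>"
    have "l n \<in> {0, 1}" "l' n \<in> {0, 1}" for n using l(1,2) by (auto simp: Sigma2_def)
    then have "real_of_int \<bar>l n - l' n\<bar> \<le> 1" for n
      by (smt (verit) insert_iff singletonD of_int_le_1_iff)
    then have dW: "?d n \<le> W n" for n
      unfolding W_def by (intro divide_right_mono) simp_all
    have "sigma_dist l l' = infsum ?d (- F)"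
      unfolding sigma_dist_def by (rule infsum_cong_neutral) (use l(3) in auto)
    also have "\<dots> \<le> infsum W (- F)"
      by (intro infsum_mono summable_on_comparison_test[OF tail] tail dW) auto
    also have "\<dots> < e" using le assms by linarith
    finally show ?thesis .
  qed
  with F(1) show ?thesis by (rule that)
qed

lemma set_a_eq: "set_a = supp 0" and set_b_eq: "set_b = supp 1"
  by (simp_all add: set_a_def set_b_def supp_def Ca_inv_eq Cb_inv_eq)

lemma Ca_eq: "Ca = chart 0" and Cb_eq: "Cb = chart 1"
  by (simp_all add: Ca_def Cb_def Ca_inv_eq Cb_inv_eq inv_param)

section \<open>Orbits and their symbols\<close>

lemma orbit_exists:
  fixes l :: "int \<Rightarrow> int"
  shows "\<exists>w. (\<forall>i. w i \<in> supp (l i)) \<and> (\<forall>i. w (i + 1) = (H ^^ 4) (w i))"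
proof -
  obtain v where v: "\<And>i. v i \<in> Bcube" "\<And>i. transition (l i) (l (i + 1)) (v i) = v (i + 1)"
    using transition_orbit_exists by blast
  have "param (l (i + 1)) (v (i + 1)) = (H ^^ 4) (param (l i) (v i))" for i
    using v(2)[of i] by (metis transition_def param_chart)
  with v(1) show ?thesis
    by (intro exI[of _ "\<lambda>i. param (l i) (v i)"]) (auto simp: supp_def)
qed

text \<open>The default outside both supports matches that of the coding map, so the two agree at
  every point.\<close>

definition symbol :: "real^3 \<Rightarrow> int" where
  "symbol w = (if w \<in> supp 0 then 0 else if w \<in> supp 1 then 1 else undefined)"

lemma symbol_supp: "s \<in> {0, 1} \<Longrightarrow> w \<in> supp s \<Longrightarrow> symbol w = s"
  using supp_disjoint by (auto simp: symbol_def)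

text \<open>The support with the other symbol, \<open>1 - s\<close>, is compact and misses
  \<open>w\<close>, hence misses a ball around it.\<close>

lemma symbol_locally_constant:
  assumes w: "w \<in> supp 0 \<union> supp 1"
  obtains d where "d > 0" "\<And>w'. \<lbrakk>w' \<in> supp 0 \<union> supp 1; dist w w' < d\<rbrakk> \<Longrightarrow> symbol w' = symbol w"
proof -
  obtain s where s: "s \<in> {0, 1}" "w \<in> supp s" using w by auto
  then have "w \<in> - supp (1 - s)" using supp_disjoint by auto
  moreover have "open (- supp (1 - s))" using compact_supp by (simp add: compact_imp_closed open_Compl)
  ultimately obtain d where d: "d > 0" "\<And>w'. dist w' w < d \<Longrightarrow> w' \<in> - supp (1 - s)"
    unfolding open_dist by blast
  have "symbol w' = symbol w" if "w' \<in> supp 0 \<union> supp 1" "dist w w' < d" for w'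
  proof -
    have "w' \<in> supp s" using d(2)[of w'] that s(1) by (auto simp: dist_commute)
    with s show ?thesis by (simp add: symbol_supp)
  qed
  with d(1) show ?thesis by (rule that)
qed

theorem theorem3p4:
  defines "f \<equiv> H ^^ 4"
    and "I \<equiv> Inv_part (H ^^ 4) (set_a \<union> set_b)"
    and "g \<equiv> (\<lambda>x. (\<lambda>k::int. if iter_int H (4 * k) x \<in> set_a then 0
                                 else if iter_int H (4 * k) x \<in> set_b then 1 else undefined))"
  shows "covers set_a (split3 \<circ> Ca) f set_a (split3 \<circ> Ca)
       \<and> covers set_a (split3 \<circ> Ca) f set_b (split3 \<circ> Cb)
       \<and> covers set_b (split3 \<circ> Cb) f set_b (split3 \<circ> Cb)
       \<and> covers set_b (split3 \<circ> Cb) f set_a (split3 \<circ> Ca)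
       \<and> (\<forall>x\<in>I. \<forall>e>0. \<exists>d>0. \<forall>y\<in>I. dist x y < d \<longrightarrow> sigma_dist (g x) (g y) < e)
       \<and> g ` I = Sigma2
       \<and> (\<forall>x\<in>I. g (f x) = shift (g x))"
proof -
  have iter4: "iter_int (H ^^ 4) k x = iter_int H (4 * k) x" for k x
    using iter_int_funpow[OF bij_H, of 4] by simp
  have I: "x \<in> I \<longleftrightarrow> (\<forall>k. iter_int H (4 * k) x \<in> supp 0 \<union> supp 1)" for x
  proof -
    \<comment> \<open>Time 0 absorbs the separate membership condition in
      \<open>Inv_part\<close>.\<close>
    have "iter_int H (4 * 0) x = x" by (simp add: iter_int_def)
    then show ?thesis
      unfolding I_def Inv_part_def iter4 set_a_eq set_b_eq mem_Collect_eq by metis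
  qed
  have g: "g x k = symbol (iter_int H (4 * k) x)" for x k
    by (simp add: g_def symbol_def set_a_eq set_b_eq)
  have gI: "g x \<in> Sigma2" if "x \<in> I" for x
    using that unfolding I Sigma2_def g by (auto simp: symbol_def)
  have cont: "\<exists>d>0. \<forall>y\<in>I. dist x y < d \<longrightarrow> sigma_dist (g x) (g y) < e"
    if x: "x \<in> I" and e: "e > 0" for x e
  proof -
    obtain F where F: "finite F"
      "\<And>l l'. \<lbrakk>l \<in> Sigma2; l' \<in> Sigma2; \<forall>n\<in>F. l n = l' n\<rbrakk> \<Longrightarrow> sigma_dist l l' < e"
      using sigma_dist_small[OF e] by blast
    \<comment> \<open>Each single symbol is locally constant along \<open>I\<close>, as
      \<open>iter_int H (4 * k)\<close> is continuous; only the finitely many symbols in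
      \<open>F\<close> have to be fixed at once.\<close>
    have "eventually (\<lambda>y. y \<in> I \<longrightarrow> g y k = g x k) (at x)" for k
    proof -
      obtain d where d: "d > 0" "\<And>w'. \<lbrakk>w' \<in> supp 0 \<union> supp 1; dist (iter_int H (4 * k) x) w' < d\<rbrakk>
          \<Longrightarrow> symbol w' = symbol (iter_int H (4 * k) x)"
        using symbol_locally_constant[of "iter_int H (4 * k) x"] x I by blast
      have "(iter_int H (4 * k) \<longlongrightarrow> iter_int H (4 * k) x) (at x)"
        using continuous_on_iter_int_H[of UNIV] by (simp add: continuous_on_def)
      from tendstoD[OF this d(1)] show ?thesis
        by eventually_elim (use d(2) in \<open>auto simp: g I dist_commute\<close>)
    qed
    then have "eventually (\<lambda>y. \<forall>k\<in>F. y \<in> I \<longrightarrow> g y k = g x k) (at x)"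
      using F(1) by (intro eventually_ball_finite) auto
    then obtain d where d: "d > 0"
      "\<And>y. \<lbrakk>y \<noteq> x; dist y x < d; y \<in> I\<rbrakk> \<Longrightarrow> \<forall>k\<in>F. g y k = g x k"
      unfolding eventually_at by blast
    have "sigma_dist (g x) (g y) < e" if "y \<in> I" "dist x y < d" for y
      using d(2)[of y] that gI[OF x] gI[of y]
      \<comment> \<open>The filter \<open>at x\<close> omits \<open>x\<close> itself, hence the
        separate case.\<close>
      by (intro F(2)) (cases "y = x"; auto simp: dist_commute)+
    with d(1) show ?thesis by blast
  qed
  have surj: "Sigma2 \<subseteq> g ` I"
  proof
    fix l assume l: "l \<in> Sigma2"
    obtain w where w: "\<And>k. w k \<in> supp (l k)" "\<And>k. w (k + 1) = (H ^^ 4) (w k)"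
      using orbit_exists by blast
    have iter: "iter_int H (4 * k) (w 0) = w k" for k
      using iter_int_unique[OF bij_fn[OF bij_H], of w 4 k] w(2) by (simp add: iter4)
    have l01: "l k \<in> {0, 1}" for k using l by (auto simp: Sigma2_def)
    have "w k \<in> supp 0 \<union> supp 1" for k using w(1)[of k] l01[of k] by auto
    then have "w 0 \<in> I" by (simp add: I iter)
    moreover have "g (w 0) = l"
      using symbol_supp[OF l01 w(1)] by (auto simp: g iter)
    ultimately show "l \<in> g ` I" by blast
  qed
  have "g (f x) = shift (g x)" for x
  proof
    fix k
    have "iter_int (H ^^ 4) k ((H ^^ 4) x) = iter_int (H ^^ 4) (k + 1) x"
      by (rule iter_int_shift) (rule bij_fn[OF bij_H])
    then show "g (f x) k = shift (g x) k" by (simp add: g f_def shift_def iter4)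
  qed
  with cont surj gI show ?thesis
    unfolding f_def set_a_eq set_b_eq Ca_eq Cb_eq by (auto simp: covers_supp)
qed

end
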